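(* Let $x\mapsto|\psi_x\rangle$ be a differentiable family of unit vectors in a complex Hilbert space, and fix a value of $x$ with $I(\rho_x)>0$, where $\rho_x=|\psi_x\rangle\langle\psi_x|$. Let $\rho_x^\perp=|\psi_x^\perp\rangle\langle\psi_x^\perp|$. (i) If a post-selection measurement with POVM operators $\{E_\omega\}_{\omega\in\Omega}$ and retained set $\checkmark\subset\Omega$ is an efficient lossless compression channel at $x$, then for every $\omega\in\checkmark$ $$E_\omega=q_\omega\,\rho_x^\perp+\Lambda_\omega ,$$ where $q_\omega\in(0,1]$, $\sum_{\omega\in\checkmark}q_\omega=1$, and the operators $\Lambda_\omega$ satisfy $$\langle\psi_x^\perp|\Lambda_\omega|\psi_x^\perp\rangle=\langle\psi_x^\perp|\Lambda_\omega|\psi_x\rangle=0,\qquad \langle\psi_x|\Lambda_\omega|\psi_x\rangle=\lambda_\omega\in(0,1).$$ (ii) Conversely, the operators $\Lambda_\omega$ may be chosen arbitrarily subject to these conditions: if $\{E_\omega\}_{\omega\in\Omega}$ is a POVM whose retained elements have the form in (i), with $q_\omega$, $\Lambda_\omega$, $\lambda_\omega$ satisfying all the conditions in (i), and $\sum_{\omega\in\checkmark}\lambda_\omega<1$, then the post-selection measurement is an efficient lossless compression channel at $x$. (iii) In this situation the compression capacity and the compression gain are $$c=\frac{1}{\sum_{\omega\in\checkmark}\lambda_\omega},\qquad \eta=\sum_{\omega\in\checkmark}\frac{q_\omega}{\lambda_\omega}.$$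
   Context: Notation. $|\partial_x^\perp\psi_x\rangle=|\partial_x\psi_x\rangle-\langle\psi_x|\partial_x\psi_x\rangle|\psi_x\rangle$, $g(\rho_x)=\langle\partial_x^\perp\psi_x|\partial_x^\perp\psi_x\rangle$, $|\psi_x^\perp\rangle=|\partial_x^\perp\psi_x\rangle/\sqrt{g(\rho_x)}$. The quantum Fisher information (QFI) of a pure state given by unit vectors $|\chi_x\rangle$ is $4\left(\langle\partial_x\chi_x|\partial_x\chi_x\rangle-|\langle\chi_x|\partial_x\chi_x\rangle|^2\right)$; in particular $I(\rho_x)=4g(\rho_x)$. Post-selection. A post-selection measurement is a finite family of bounded operators $\{K_\omega\}_{\omega\in\Omega}$ with $E_\omega=K_\omega^\dagger K_\omega$ and $\sum_{\omega\in\Omega}E_\omega=\mathbb I$, with the outcome set split as $\Omega=\checkmark\cup\times$ into disjoint sets of retained and discarded outcomes. The $K_\omega$ are held fixed when differentiating in $x$ (only $|\psi_x\rangle$ is differentiated). Put $p(\omega|x)=\langle\psi_x|E_\omega|\psi_x\rangle$ and let $\sigma_{x|\omega}$ be the pure state with unit vector $K_\omega|\psi_x\rangle/\sqrt{p(\omega|x)}$, with QFI $I(\sigma_{x|\omega})$. Standing assumptions on retained outcomes $\omega\in\checkmark$: $p(\omega|x)\ne0$ (no null POVM operator is retained) and $\sqrt{E_\omega}\,|\partial_x^\perp\psi_x\rangle\neq0$ (no outcome that trivially carries no information is retained). The loss is $\gamma=1-\sum_{\omega\in\checkmark}p(\omega|x)I(\sigma_{x|\omega})/I(\rho_x)$,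 the compression capacity is $c=1/\sum_{\omega\in\checkmark}p(\omega|x)$, and the compression gain is $\eta=\sum_{\omega\in\checkmark}I(\sigma_{x|\omega})/I(\rho_x)$. The measurement is a lossless compression channel (LCC) if $\gamma=0$ and $c>1$; it is efficient if $c\in(1,\infty)$. *)

theory Defs
  imports "HOL-Analysis.Analysis"
begin

section \<open>Complex Hilbert spaces\<close>

text \<open>The inner product is antilinear in the first and linear in the second argument.
  Completeness comes from the class \<open>banach\<close>.\<close>

class chilbert_space = banach +
  fixes scaleC :: "complex \<Rightarrow> 'a \<Rightarrow> 'a"  (infixr \<open>*\<^sub>C\<close> 75)
    and cinner :: "'a \<Rightarrow> 'a \<Rightarrow> complex"
  assumes scaleC_add_right: "a *\<^sub>C (u + v) = a *\<^sub>C u + a *\<^sub>C v"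
    and scaleC_add_left: "(a + b) *\<^sub>C u = a *\<^sub>C u + b *\<^sub>C u"
    and scaleC_scaleC: "a *\<^sub>C (b *\<^sub>C u) = (a * b) *\<^sub>C u"
    and scaleR_scaleC: "scaleR r u = complex_of_real r *\<^sub>C u"
    and cinner_commute: "cinner u v = cnj (cinner v u)"
    and cinner_add_right: "cinner u (v + w) = cinner u v + cinner u w"
    and cinner_scaleC_right: "cinner u (a *\<^sub>C v) = a * cinner u v"
    and cinner_self: "cinner u u = complex_of_real ((norm u)\<^sup>2)"

instantiation complex :: chilbert_space
begin

definition scaleC_complex :: "complex \<Rightarrow> complex \<Rightarrow> complex"
  where "scaleC_complex a u = a * u"

definition cinner_complex :: "complex \<Rightarrow> complex \<Rightarrow> complex"
  where "cinner_complex u v = cnj u * v"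

instance
  by standard
    (simp_all add: scaleC_complex_def cinner_complex_def algebra_simps scaleR_conv_of_real
      complex_norm_square [symmetric])

end

section \<open>Operators\<close>

definition bounded_clinear :: "('a::chilbert_space \<Rightarrow> 'a) \<Rightarrow> bool"
  where "bounded_clinear A \<longleftrightarrow> bounded_linear A \<and> (\<forall>c v. A (c *\<^sub>C v) = c *\<^sub>C A v)"

text \<open>The two definite descriptions below are meaningful on bounded operators (by Riesz
  representation), respectively on bounded positive operators.\<close>

definition cadjoint :: "('a::chilbert_space \<Rightarrow> 'a) \<Rightarrow> 'a \<Rightarrow> 'a"
  where "cadjoint A = (THE B. \<forall>u v. cinner (B u) v = cinner u (A v))"

definition positive_op :: "('a::chilbert_space \<Rightarrow> 'a) \<Rightarrow> bool"
  where "positive_op A \<longleftrightarrow>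
    bounded_clinear A \<and> (\<forall>v. cinner v (A v) \<in> \<real> \<and> 0 \<le> Re (cinner v (A v)))"

definition op_sqrt :: "('a::chilbert_space \<Rightarrow> 'a) \<Rightarrow> 'a \<Rightarrow> 'a"
  where "op_sqrt A = (THE S. positive_op S \<and> S \<circ> S = A)"

definition ket_bra :: "'a::chilbert_space \<Rightarrow> 'a \<Rightarrow> 'a \<Rightarrow> 'a"
  where "ket_bra u v = (\<lambda>w. cinner v w *\<^sub>C u)"

section \<open>Pure state families and quantum Fisher information\<close>

definition perp_deriv :: "(real \<Rightarrow> 'a::chilbert_space) \<Rightarrow> real \<Rightarrow> 'a"
  where "perp_deriv \<psi> x =
    vector_derivative \<psi> (at x) - cinner (\<psi> x) (vector_derivative \<psi> (at x)) *\<^sub>C \<psi> x"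

definition metric_g :: "(real \<Rightarrow> 'a::chilbert_space) \<Rightarrow> real \<Rightarrow> real"
  where "metric_g \<psi> x = Re (cinner (perp_deriv \<psi> x) (perp_deriv \<psi> x))"

definition perp_state :: "(real \<Rightarrow> 'a::chilbert_space) \<Rightarrow> real \<Rightarrow> 'a"
  where "perp_state \<psi> x = (1 / sqrt (metric_g \<psi> x)) *\<^sub>R perp_deriv \<psi> x"

definition qfi :: "(real \<Rightarrow> 'a::chilbert_space) \<Rightarrow> real \<Rightarrow> real"
  where "qfi \<phi> x =
    4 * (Re (cinner (vector_derivative \<phi> (at x)) (vector_derivative \<phi> (at x)))
         - (cmod (cinner (\<phi> x) (vector_derivative \<phi> (at x))))\<^sup>2)"

section \<open>Post-selection\<close>

text \<open>\<open>\<Omega>\<close> is the set of all outcomes, \<open>R\<close> the set of retained outcomes; the discarded outcomes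
  are \<open>\<Omega> - R\<close>.\<close>

definition povm :: "('w \<Rightarrow> 'a::chilbert_space \<Rightarrow> 'a) \<Rightarrow> 'w \<Rightarrow> 'a \<Rightarrow> 'a"
  where "povm K \<omega> = cadjoint (K \<omega>) \<circ> K \<omega>"

definition post_selection :: "('w \<Rightarrow> 'a::chilbert_space \<Rightarrow> 'a) \<Rightarrow> 'w set \<Rightarrow> 'w set \<Rightarrow> bool"
  where "post_selection K \<Omega> R \<longleftrightarrow>
    finite \<Omega> \<and> R \<subseteq> \<Omega> \<and> (\<forall>\<omega>\<in>\<Omega>. bounded_clinear (K \<omega>)) \<and>
    (\<forall>v. (\<Sum>\<omega>\<in>\<Omega>. povm K \<omega> v) = v)"

definition outcome_prob ::
    "('w \<Rightarrow> 'a::chilbert_space \<Rightarrow> 'a) \<Rightarrow> (real \<Rightarrow> 'a) \<Rightarrow> 'w \<Rightarrow> real \<Rightarrow> real"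
  where "outcome_prob K \<psi> \<omega> x = Re (cinner (\<psi> x) (povm K \<omega> (\<psi> x)))"

definition post_state ::
    "('w \<Rightarrow> 'a::chilbert_space \<Rightarrow> 'a) \<Rightarrow> (real \<Rightarrow> 'a) \<Rightarrow> 'w \<Rightarrow> real \<Rightarrow> 'a"
  where "post_state K \<psi> \<omega> x = (1 / sqrt (outcome_prob K \<psi> \<omega> x)) *\<^sub>R K \<omega> (\<psi> x)"

definition retained_nontrivial ::
    "('w \<Rightarrow> 'a::chilbert_space \<Rightarrow> 'a) \<Rightarrow> 'w set \<Rightarrow> (real \<Rightarrow> 'a) \<Rightarrow> real \<Rightarrow> bool"
  where "retained_nontrivial K R \<psi> x \<longleftrightarrow>
    (\<forall>\<omega>\<in>R. outcome_prob K \<psi> \<omega> x \<noteq> 0 \<and> op_sqrt (povm K \<omega>) (perp_deriv \<psi> x) \<noteq> 0)"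

definition loss ::
    "('w \<Rightarrow> 'a::chilbert_space \<Rightarrow> 'a) \<Rightarrow> 'w set \<Rightarrow> (real \<Rightarrow> 'a) \<Rightarrow> real \<Rightarrow> real"
  where "loss K R \<psi> x =
    1 - (\<Sum>\<omega>\<in>R. outcome_prob K \<psi> \<omega> x * qfi (post_state K \<psi> \<omega>) x / qfi \<psi> x)"

text \<open>The capacity is extended-real valued, with value \<open>\<infinity>\<close> when the total retained probability
  vanishes.\<close>

definition compression_capacity ::
    "('w \<Rightarrow> 'a::chilbert_space \<Rightarrow> 'a) \<Rightarrow> 'w set \<Rightarrow> (real \<Rightarrow> 'a) \<Rightarrow> real \<Rightarrow> ereal"
  where "compression_capacity K R \<psi> x = 1 / ereal (\<Sum>\<omega>\<in>R. outcome_prob K \<psi> \<omega> x)"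

definition compression_gain ::
    "('w \<Rightarrow> 'a::chilbert_space \<Rightarrow> 'a) \<Rightarrow> 'w set \<Rightarrow> (real \<Rightarrow> 'a) \<Rightarrow> real \<Rightarrow> real"
  where "compression_gain K R \<psi> x = (\<Sum>\<omega>\<in>R. qfi (post_state K \<psi> \<omega>) x / qfi \<psi> x)"

definition lossless_compression ::
    "('w \<Rightarrow> 'a::chilbert_space \<Rightarrow> 'a) \<Rightarrow> 'w set \<Rightarrow> (real \<Rightarrow> 'a) \<Rightarrow> real \<Rightarrow> bool"
  where "lossless_compression K R \<psi> x \<longleftrightarrow> loss K R \<psi> x = 0 \<and> compression_capacity K R \<psi> x > 1"

definition efficient ::
    "('w \<Rightarrow> 'a::chilbert_space \<Rightarrow> 'a) \<Rightarrow> 'w set \<Rightarrow> (real \<Rightarrow> 'a) \<Rightarrow> real \<Rightarrow> bool"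
  where "efficient K R \<psi> x \<longleftrightarrow> compression_capacity K R \<psi> x \<in> {1<..<\<infinity>}"

text \<open>The decomposition of retained POVM elements; \<open>E\<close> is the POVM and \<open>l \<omega>\<close> is the number
  \<open>\<lambda>\<^sub>\<omega>\<close>.\<close>

definition lcc_form ::
    "('w \<Rightarrow> 'a::chilbert_space \<Rightarrow> 'a) \<Rightarrow> 'w set \<Rightarrow> (real \<Rightarrow> 'a) \<Rightarrow> real \<Rightarrow>
      ('w \<Rightarrow> real) \<Rightarrow> ('w \<Rightarrow> 'a \<Rightarrow> 'a) \<Rightarrow> ('w \<Rightarrow> real) \<Rightarrow> bool"
  where "lcc_form E R \<psi> x q \<Lambda> l \<longleftrightarrow>
    (\<forall>\<omega>\<in>R.
      E \<omega> = (\<lambda>v. q \<omega> *\<^sub>R ket_bra (perp_state \<psi> x) (perp_state \<psi> x) v + \<Lambda> \<omega> v) \<and>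
      q \<omega> \<in> {0<..1} \<and>
      bounded_clinear (\<Lambda> \<omega>) \<and>
      cinner (perp_state \<psi> x) (\<Lambda> \<omega> (perp_state \<psi> x)) = 0 \<and>
      cinner (perp_state \<psi> x) (\<Lambda> \<omega> (\<psi> x)) = 0 \<and>
      cinner (\<psi> x) (\<Lambda> \<omega> (\<psi> x)) = complex_of_real (l \<omega>) \<and>
      l \<omega> \<in> {0<..<1}) \<and>
    (\<Sum>\<omega>\<in>R. q \<omega>) = 1"

end

theory Submission imports Defs begin

text \<open>Write \<open>d\<close> for the perpendicular derivative, \<open>g = \<parallel>d\<parallel>\<^sup>2\<close> and \<open>p = \<parallel>K \<psi>\<parallel>\<^sup>2\<close> for an outcome. The
  information an outcome transmits, relative to \<open>I(\<rho>) = 4 g\<close>, is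
  \<open>\<parallel>K d\<parallel>\<^sup>2 / g - \<bar>\<langle>K \<psi>, K d\<rangle>\<bar>\<^sup>2 / (p g)\<close>. The first terms sum to at most \<open>1\<close> over the retained
  outcomes, so there is no loss iff they sum to exactly \<open>1\<close> and \<open>\<langle>\<psi>, E d\<rangle> = \<langle>K \<psi>, K d\<rangle>\<close> vanishes for
  every retained outcome. Then \<open>q = \<parallel>K d\<parallel>\<^sup>2 / g\<close> and \<open>\<lambda> = p\<close>; positivity of \<open>q\<close> is the assumption
  that \<open>\<surd>E\<close> does not annihilate \<open>d\<close>, which is why positive operators must be shown to have a
  unique positive square root.\<close>


section \<open>Inner product calculus, Cauchy-Schwarz and continuity\<close>

lemma cinner_add_left: "cinner (u + v) (w::'a::chilbert_space) = cinner u w + cinner v w"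
  by (metis cinner_add_right cinner_commute complex_cnj_add)

lemma cinner_scaleC_left: "cinner (a *\<^sub>C u) (v::'a::chilbert_space) = cnj a * cinner u v"
  by (metis cinner_scaleC_right cinner_commute complex_cnj_mult)

lemma cinner_scaleR_right: "cinner u (r *\<^sub>R (v::'a::chilbert_space)) = of_real r * cinner u v"
  by (simp add: scaleR_scaleC cinner_scaleC_right)

lemma cinner_scaleR_left: "cinner (r *\<^sub>R u) (v::'a::chilbert_space) = of_real r * cinner u v"
  by (simp add: scaleR_scaleC cinner_scaleC_left)

lemma cinner_minus_right: "cinner u (- (v::'a::chilbert_space)) = - cinner u v"
  using cinner_scaleR_right[of u "-1" v] by simp

lemma cinner_minus_left: "cinner (- u) (v::'a::chilbert_space) = - cinner u v"
  using cinner_scaleR_left[of "-1" u v] by simp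

lemma cinner_diff_right: "cinner u (v - (w::'a::chilbert_space)) = cinner u v - cinner u w"
  using cinner_add_right[of u v "- w"] by (simp add: cinner_minus_right)

lemma cinner_diff_left: "cinner (u - v) (w::'a::chilbert_space) = cinner u w - cinner v w"
  using cinner_add_left[of u "- v" w] by (simp add: cinner_minus_left)

lemma cinner_zero_right: "cinner u (0::'a::chilbert_space) = 0"
  using cinner_scaleR_right[of u 0 0] by simp

lemma cinner_zero_left: "cinner (0::'a::chilbert_space) u = 0"
  using cinner_scaleR_left[of 0 0 u] by simp

lemma cinner_sum_right: "cinner u (\<Sum>i\<in>I. f i) = (\<Sum>i\<in>I. cinner u (f i :: 'a::chilbert_space))"
  by (induction I rule: infinite_finite_induct) (simp_all add: cinner_zero_right cinner_add_right)

lemmas cinner_simps = cinner_add_left cinner_add_right cinner_diff_left cinner_diff_right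
  cinner_scaleC_left cinner_scaleC_right cinner_scaleR_left cinner_scaleR_right
  cinner_minus_left cinner_minus_right cinner_zero_left cinner_zero_right

lemma Re_cinner_commute: "Re (cinner u v) = Re (cinner v (u::'a::chilbert_space))"
  by (metis cinner_commute complex_cnj(1) cnj.simps(1))

lemma power2_norm_eq_Re_cinner: "(norm u)\<^sup>2 = Re (cinner u (u::'a::chilbert_space))"
  by (simp add: cinner_self)

lemma norm_scaleC: "norm (a *\<^sub>C u) = cmod a * norm (u::'a::chilbert_space)"
proof -
  have "cinner (a *\<^sub>C u) (a *\<^sub>C u) = of_real ((cmod a * norm u)\<^sup>2)"
    by (simp only: cinner_simps cinner_self[of u] power_mult_distrib of_real_mult complex_norm_square
        mult.assoc mult.commute mult.left_commute)
  hence "(norm (a *\<^sub>C u))\<^sup>2 = (cmod a * norm u)\<^sup>2"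
    by (simp only: cinner_self of_real_eq_iff)
  thus ?thesis by (simp add: power2_eq_iff_nonneg)
qed

text \<open>Pythagoras, for \<open>v\<close> minus its component along a unit vector. It yields
  Cauchy-Schwarz below, and later identifies the two terms of the QFI with one squared norm.\<close>

lemma norm_diff_scaleC_square:
  fixes u v :: "'a::chilbert_space"
  assumes "norm u = 1"
  shows "(norm (v - cinner u v *\<^sub>C u))\<^sup>2 = (norm v)\<^sup>2 - (cmod (cinner u v))\<^sup>2"
proof -
  have "of_real ((norm (v - cinner u v *\<^sub>C u))\<^sup>2)
      = (of_real ((norm v)\<^sup>2 - (cmod (cinner u v))\<^sup>2) :: complex)"
    using assms cinner_self[of u] cinner_commute[of v u]
    by (simp add: cinner_self[of v, symmetric] cinner_self[of "v - cinner u v *\<^sub>C u", symmetric]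
        cinner_simps complex_norm_square algebra_simps del: of_real_power)
  thus ?thesis by (simp only: of_real_eq_iff)
qed

lemma cmod_cinner_le: "cmod (cinner u v) \<le> norm u * norm (v::'a::chilbert_space)"
proof (cases "u = 0")
  case False
  define e where "e = (1 / norm u) *\<^sub>R u"
  have e: "norm e = 1" using False by (simp add: e_def)
  have "(cmod (cinner e v))\<^sup>2 \<le> (norm v)\<^sup>2"
    using norm_diff_scaleC_square[OF e, of v] zero_le_power2[of "norm (v - cinner e v *\<^sub>C e)"] by linarith
  hence "cmod (cinner e v) \<le> norm v" by (simp add: power2_le_iff_abs_le)
  moreover have "cmod (cinner e v) = cmod (cinner u v) / norm u"
    by (simp add: e_def cinner_simps norm_mult norm_divide)
  ultimately show ?thesis using False by (simp add: field_simps)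
qed (simp add: cinner_zero_left)

text \<open>Antilinearity in the first argument is still real linearity, so the limit and product
  rules for real bounded bilinear maps apply.\<close>

lemma bounded_bilinear_cinner: "bounded_bilinear (cinner :: 'a::chilbert_space \<Rightarrow> _)"
proof
  show "\<exists>K. \<forall>a b::'a. norm (cinner a b) \<le> norm a * norm b * K"
    using cmod_cinner_le by (intro exI[of _ 1]) auto
qed (simp_all add: cinner_simps scaleR_conv_of_real)

lemmas tendsto_cinner = bounded_bilinear.tendsto[OF bounded_bilinear_cinner]

lemma bounded_linear_scaleC: "bounded_linear (\<lambda>u::'a::chilbert_space. a *\<^sub>C u)"
  by (rule bounded_linear_intro[where K = "cmod a"])
    (simp_all add: scaleC_add_right scaleR_scaleC scaleC_scaleC norm_scaleC mult.commute)

lemma cinner_right_eqI: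
  assumes "\<And>w. cinner w u = cinner w (v::'a::chilbert_space)"
  shows "u = v"
proof -
  have "cinner (u - v) (u - v) = 0" using assms by (simp add: cinner_simps)
  thus ?thesis by (simp add: cinner_self)
qed

lemma cinner_left_eqI:
  assumes "\<And>w. cinner u w = cinner (v::'a::chilbert_space) w"
  shows "u = v"
  by (rule cinner_right_eqI) (metis assms cinner_commute)

section \<open>Riesz representation and adjoints\<close>

lemma parallelogram:
  "(norm (u + v))\<^sup>2 + (norm (u - v))\<^sup>2 = 2 * (norm u)\<^sup>2 + 2 * (norm (v::'a::chilbert_space))\<^sup>2"
  by (simp add: power2_norm_eq_Re_cinner cinner_simps)

text \<open>The representing vector minimises \<open>\<parallel>v\<parallel>\<^sup>2 - 2 Re (f v)\<close>; by the parallelogram law every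
  minimising sequence is Cauchy.\<close>

lemma riesz_real:
  fixes f :: "'a::chilbert_space \<Rightarrow> real"
  assumes f: "bounded_linear f"
  obtains z where "\<And>w. f w = Re (cinner z w)"
proof -
  interpret f: bounded_linear f by fact
  define J where "J v = (norm v)\<^sup>2 - 2 * f v" for v
  obtain M where M: "\<And>v. norm (f v) \<le> norm v * M" using f.bounded by blast
  \<comment> \<open>Completing the square: \<open>J v\<close> is at least
    \<open>(norm v - M)^2 - M^2\<close>.\<close>
  have lower: "- M\<^sup>2 \<le> J v" for v
  proof -
    have "f v \<le> norm v * M" using M[of v] by simp
    moreover have "0 \<le> (norm v - M)\<^sup>2" by simp
    ultimately show ?thesis by (simp add: J_def power2_eq_square algebra_simps)
  qed
  define m where "m = (INF v. J v)"
  have bdd: "bdd_below (range J)" using lower by (auto intro!: bdd_belowI)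
  have m_le: "m \<le> J v" for v unfolding m_def by (rule cINF_lower[OF bdd]) simp
  have "\<exists>v. J v < m + 1 / real (Suc n)" for n
  proof -
    have "m < m + 1 / real (Suc n)" by simp
    thus ?thesis
      using cINF_less_iff[OF _ bdd, of "m + 1 / real (Suc n)"] by (simp add: m_def)
  qed
  then obtain v where v: "\<And>n. J (v n) < m + 1 / real (Suc n)" by metis
  \<comment> \<open>The midpoint of \<open>a\<close> and \<open>b\<close> also has \<open>J\<close>
    at least \<open>m\<close>; the parallelogram law turns this into a bound on their
    distance.\<close>
  have par: "(norm (a - b))\<^sup>2 \<le> 2 * (J a - m) + 2 * (J b - m)" for a b
  proof -
    have "(norm ((1/2) *\<^sub>R (a + b)))\<^sup>2 = (norm (a + b))\<^sup>2 / 4"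
      by (simp only: norm_scaleR) (simp add: power_divide)
    moreover have "f ((1/2) *\<^sub>R (a + b)) = (f a + f b) / 2"
      by (simp only: f.scaleR f.add) simp
    ultimately have "J ((1/2) *\<^sub>R (a + b)) = (norm (a + b))\<^sup>2 / 4 - f a - f b"
      by (simp add: J_def del: scaleR_add_right norm_scaleR)
    thus ?thesis using m_le[of "(1/2) *\<^sub>R (a + b)"] parallelogram[of a b] by (simp add: J_def)
  qed
  have "Cauchy v"
  proof (rule metric_CauchyI)
    fix e :: real assume "e > 0"
    \<comment> \<open>With each excess over \<open>m\<close> below \<open>e^2 / 4\<close>, the two
      terms of \<open>par\<close> add up to less than \<open>e^2\<close>.\<close>
    then obtain N where N: "1 / real (Suc N) < e\<^sup>2 / 4"
      using nat_approx_posE[of "e\<^sup>2 / 4"] by auto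
    have "dist (v i) (v j) < e" if "i \<ge> N" "j \<ge> N" for i j
    proof -
      have "1 / real (Suc k) \<le> 1 / real (Suc N)" if "k \<ge> N" for k
        using that by (simp add: frac_le)
      hence "J (v k) - m < e\<^sup>2 / 4" if "k \<ge> N" for k
        using v[of k] N that by fastforce
      from this[OF that(1)] this[OF that(2)]
      have "2 * (J (v i) - m) + 2 * (J (v j) - m) < e\<^sup>2" by argo
      with par[of "v i" "v j"] have "(norm (v i - v j))\<^sup>2 < e\<^sup>2" by (rule le_less_trans)
      thus ?thesis using \<open>e > 0\<close> by (simp add: dist_norm power_less_imp_less_base)
    qed
    thus "\<exists>N. \<forall>i\<ge>N. \<forall>j\<ge>N. dist (v i) (v j) < e" by blast
  qed
  then obtain z where z: "v \<longlonglongrightarrow> z" using Cauchy_convergent_iff convergent_def by blast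
  have "(\<lambda>n. J (v n)) \<longlonglongrightarrow> J z"
    unfolding J_def by (intro tendsto_intros z f.tendsto)
  moreover have "(\<lambda>n. m + 1 / real (Suc n)) \<longlonglongrightarrow> m + 0"
    by (intro tendsto_intros LIMSEQ_Suc[OF lim_1_over_n])
  ultimately have "J z \<le> m + 0"
    by (rule LIMSEQ_le) (use v in \<open>auto intro: less_imp_le\<close>)
  hence J_min: "J z \<le> J w" for w using m_le[of w] by simp
  have "f w = Re (cinner z w)" for w
  proof (cases "w = 0")
    case False
    \<comment> \<open>Half the derivative of \<open>J\<close> at the minimiser \<open>z\<close> in
      direction \<open>w\<close>; it has to vanish.\<close>
    define b where "b = Re (cinner z w) - f w"
    have "(norm (z + t *\<^sub>R w))\<^sup>2 = (norm z)\<^sup>2 + 2 * t * Re (cinner z w) + t\<^sup>2 * (norm w)\<^sup>2"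
      for t
      by (simp only: power2_norm_eq_Re_cinner cinner_simps)
        (simp add: Re_cinner_commute[of w z] power2_eq_square algebra_simps)
    hence expand: "J (z + t *\<^sub>R w) = J z + 2 * t * b + t\<^sup>2 * (norm w)\<^sup>2" for t
      by (simp add: J_def b_def f.add f.scaleR algebra_simps)
    have "0 \<le> 2 * t * b + t\<^sup>2 * (norm w)\<^sup>2" for t
      using J_min[of "z + t *\<^sub>R w"] expand[of t] by simp
    \<comment> \<open>This \<open>t\<close> minimises the quadratic, whose value there is
      \<open>- b^2 / (norm w)^2\<close>.\<close>
    from this[of "- b / (norm w)\<^sup>2"] have "b\<^sup>2 / (norm w)\<^sup>2 \<le> 0"
      using False by (simp add: field_simps power2_eq_square)
    hence "b = 0" using False by (simp add: divide_le_0_iff)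
    thus ?thesis by (simp add: b_def)
  qed (simp add: f.zero cinner_zero_right)
  thus thesis by (rule that)
qed

text \<open>Complex linearity recovers the imaginary part from the real one: the real part of
  \<open>f\<close> at \<open>\<i> *\<^sub>C w\<close> is minus the imaginary part of
  \<open>f w\<close>.\<close>

lemma riesz:
  fixes f :: "'a::chilbert_space \<Rightarrow> complex"
  assumes f: "bounded_linear f" and fC: "\<And>c v. f (c *\<^sub>C v) = c * f v"
  obtains z where "\<And>w. f w = cinner z w"
proof -
  obtain z where z: "\<And>w. Re (f w) = Re (cinner z w)"
    using riesz_real[OF bounded_linear_compose[OF bounded_linear_Re f]] by auto
  have "Im (f w) = Im (cinner z w)" for w
    using z[of "\<i> *\<^sub>C w"] by (simp add: fC cinner_simps)
  thus thesis using z that[of z] by (simp add: complex_eq_iff)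
qed

text \<open>Makes the definite description usable: Riesz gives existence, and a vector is determined
  by its inner products.\<close>

lemma cadjoint_works:
  fixes A :: "'a::chilbert_space \<Rightarrow> 'a"
  assumes A: "bounded_clinear A"
  shows "cinner (cadjoint A u) v = cinner u (A v)"
proof -
  have "\<exists>z. \<forall>w. cinner u (A w) = cinner z w" for u
  proof -
    have "bounded_linear (\<lambda>v. cinner u (A v))"
      using A bounded_bilinear.bounded_linear_right[OF bounded_bilinear_cinner]
      unfolding bounded_clinear_def by (blast intro: bounded_linear_compose)
    moreover have "cinner u (A (c *\<^sub>C v)) = c * cinner u (A v)" for c v
      using A by (simp add: bounded_clinear_def cinner_simps)
    ultimately show ?thesis using riesz by metis
  qed
  then obtain B where "\<forall>u v. cinner (B u) v = cinner u (A v)" by metis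
  hence "\<exists>!B. \<forall>u v. cinner (B u) v = cinner u (A v)"
    by (metis ext cinner_left_eqI)
  from theI'[OF this] show ?thesis unfolding cadjoint_def by blast
qed

lemma bounded_clinearI:
  fixes A :: "'a::chilbert_space \<Rightarrow> 'a"
  assumes "\<And>u v. A (u + v) = A u + A v" "\<And>c v. A (c *\<^sub>C v) = c *\<^sub>C A v"
    "\<And>v. norm (A v) \<le> norm v * M"
  shows "bounded_clinear A"
  unfolding bounded_clinear_def
  using assms by (auto simp: scaleR_scaleC intro!: bounded_linear_intro)

text \<open>The squared norm of \<open>cadjoint A v\<close> is the inner product of \<open>v\<close>
  with \<open>A (cadjoint A v)\<close>; Cauchy-Schwarz and cancelling one factor give the bound
  \<open>M\<close> of \<open>A\<close>.\<close>

lemma bounded_clinear_cadjoint: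
  fixes A :: "'a::chilbert_space \<Rightarrow> 'a"
  assumes A: "bounded_clinear A"
  shows "bounded_clinear (cadjoint A)"
proof -
  obtain M where M: "M > 0" "\<And>v. norm (A v) \<le> norm v * M"
    using A bounded_linear.pos_bounded unfolding bounded_clinear_def by blast
  note ad = cadjoint_works[OF A]
  show ?thesis
  proof (rule bounded_clinearI[where M = M])
    fix v
    let ?w = "cadjoint A v"
    have "(norm ?w)\<^sup>2 = Re (cinner v (A ?w))" by (simp add: power2_norm_eq_Re_cinner ad)
    also have "\<dots> \<le> norm v * norm (A ?w)" using complex_Re_le_cmod cmod_cinner_le order_trans by blast
    also have "\<dots> \<le> norm v * (norm ?w * M)" by (intro mult_left_mono M) simp
    finally have "norm ?w * norm ?w \<le> norm ?w * (norm v * M)"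
      by (simp add: power2_eq_square algebra_simps)
    thus "norm ?w \<le> norm v * M" using M(1) by (cases "norm ?w = 0") (auto simp: mult_le_cancel_left)
  qed (rule cinner_left_eqI, simp add: ad cinner_simps)+
qed

text \<open>Eliminates the adjoint: matrix elements of a POVM element become inner products of
  vectors in the range of \<open>K \<omega>\<close>.\<close>

lemma cinner_povm:
  assumes "bounded_clinear (K \<omega>)"
  shows "cinner u (povm K \<omega> v) = cinner (K \<omega> u) (K \<omega> v)"
  using cadjoint_works[OF assms] cinner_commute unfolding povm_def comp_def by metis

lemma bounded_clinear_compose:
  "bounded_clinear A \<Longrightarrow> bounded_clinear B \<Longrightarrow> bounded_clinear (A \<circ> B)"
  unfolding bounded_clinear_def comp_def by (auto intro: bounded_linear_compose)

lemma bounded_clinear_povm: "bounded_clinear (K \<omega>) \<Longrightarrow> bounded_clinear (povm K \<omega>)"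
  unfolding povm_def by (intro bounded_clinear_compose bounded_clinear_cadjoint)

lemma positive_op_povm: "bounded_clinear (K \<omega>) \<Longrightarrow> positive_op (povm K \<omega>)"
  by (simp add: positive_op_def bounded_clinear_povm cinner_povm cinner_self)

section \<open>Square roots of positive operators\<close>

text \<open>Polarisation: the defect \<open>D\<close> is sesquilinear and zero on the diagonal, so
  evaluating it at \<open>u + v\<close> and at \<open>u + \<i> *\<^sub>C v\<close> kills it
  everywhere.\<close>

lemma positive_op_selfadjoint:
  fixes A :: "'a::chilbert_space \<Rightarrow> 'a"
  assumes A: "positive_op A"
  shows "cinner u (A v) = cinner (A u) v"
proof -
  define D where "D u v = cinner u (A v) - cinner (A u) v" for u v
  interpret A: bounded_linear A using A by (simp add: positive_op_def bounded_clinear_def)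
  have AC: "A (c *\<^sub>C v) = c *\<^sub>C A v" for c v
    using A by (simp add: positive_op_def bounded_clinear_def)
  have D0: "D v v = 0" for v
    using A cinner_commute[of "A v" v] by (simp add: D_def positive_op_def Reals_cnj_iff)
  have "D u v + D v u = 0"
    using D0[of "u + v"] D0[of u] D0[of v] by (simp add: D_def A.add cinner_simps algebra_simps)
  moreover have "\<i> * (D u v - D v u) = 0"
    using D0[of "u + \<i> *\<^sub>C v"] D0[of u] D0[of v]
    by (simp add: D_def A.add AC cinner_simps algebra_simps)
  ultimately have "D u v = 0" by simp
  thus ?thesis by (simp add: D_def)
qed

text \<open>Positivity tested at \<open>v - (1/M) *\<^sub>R A v\<close>, with the cubic term in
  \<open>A\<close> bounded through \<open>M\<close>.\<close>

lemma positive_op_norm_square_le: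
  fixes A :: "'a::chilbert_space \<Rightarrow> 'a"
  assumes A: "positive_op A" and M: "M > 0" "\<And>u. norm (A u) \<le> norm u * M"
  shows "(norm (A v))\<^sup>2 \<le> M * Re (cinner v (A v))"
proof -
  interpret A: bounded_linear A using A by (simp add: positive_op_def bounded_clinear_def)
  define t where "t = 1 / M"
  have "Re (cinner (A v) (A (A v))) \<le> norm (A v) * norm (A (A v))"
    using complex_Re_le_cmod cmod_cinner_le order_trans by blast
  also have "\<dots> \<le> norm (A v) * (norm (A v) * M)" by (intro mult_left_mono M) simp
  finally have *: "Re (cinner (A v) (A (A v))) \<le> M * (norm (A v))\<^sup>2"
    by (simp add: power2_eq_square algebra_simps)
  have "0 \<le> Re (cinner (v - t *\<^sub>R A v) (A (v - t *\<^sub>R A v)))"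
    using A by (simp add: positive_op_def)
  also have "\<dots> = Re (cinner v (A v)) - 2 * t * (norm (A v))\<^sup>2 + t\<^sup>2 * Re (cinner (A v) (A (A v)))"
    by (simp add: A.diff A.scaleR cinner_simps positive_op_selfadjoint[OF A, of v "A v"]
        cinner_self power2_eq_square algebra_simps)
  also have "\<dots> \<le> Re (cinner v (A v)) - 2 * t * (norm (A v))\<^sup>2 + t\<^sup>2 * (M * (norm (A v))\<^sup>2)"
    using * by (intro add_left_mono mult_left_mono) auto
  also have "\<dots> = Re (cinner v (A v)) - (norm (A v))\<^sup>2 / M"
    using M(1) by (simp add: t_def power2_eq_square field_simps)
  finally show ?thesis using M(1) by (simp add: field_simps)
qed

lemma positive_op_eq_0:
  assumes A: "positive_op A" and 0: "Re (cinner v (A v)) = 0"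
  shows "A v = 0"
proof -
  obtain M where "M > 0" "\<And>v. norm (A v) \<le> norm v * M"
    using A bounded_linear.pos_bounded unfolding positive_op_def bounded_clinear_def by blast
  from positive_op_norm_square_le[OF A this, of v] show ?thesis using 0 by simp
qed

text \<open>The limit \<open>Y\<close> of the iteration below satisfies \<open>Y = (B + Y\<^sup>2) / 2\<close>, i.e. \<open>(1 - Y)\<^sup>2 = 1 - B\<close>.
  It is dominated in norm by the same iteration for the number \<open>1\<close>.\<close>

primrec sqrt_iter :: "('a::banach \<Rightarrow>\<^sub>L 'a) \<Rightarrow> nat \<Rightarrow> 'a \<Rightarrow>\<^sub>L 'a" where
  "sqrt_iter B 0 = 0"
| "sqrt_iter B (Suc n) = (1/2) *\<^sub>R (B + (sqrt_iter B n o\<^sub>L sqrt_iter B n))"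

primrec sqrt_bound :: "nat \<Rightarrow> real" where
  "sqrt_bound 0 = 0"
| "sqrt_bound (Suc n) = (1 + (sqrt_bound n)\<^sup>2) / 2"

lemma sqrt_bound_range: "0 \<le> sqrt_bound n \<and> sqrt_bound n \<le> 1"
proof (induction n)
  case (Suc n)
  hence "(sqrt_bound n)\<^sup>2 \<le> 1" by (simp add: power_le_one)
  thus ?case by simp
qed simp

lemma sqrt_bound_mono: "sqrt_bound n \<le> sqrt_bound (Suc n)"
proof -
  have "0 \<le> (sqrt_bound n - 1)\<^sup>2" by simp
  thus ?thesis by (simp add: power2_eq_square algebra_simps)
qed

text \<open>Each iterate is a polynomial in \<open>B\<close>. \<open>C\<close> is merely a bounded
  real-linear function, so that it can be an operator or multiplication by a complex scalar.\<close>

lemma sqrt_iter_commute: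
  assumes C: "bounded_linear C" and BC: "\<And>v. blinfun_apply B (C v) = C (blinfun_apply B v)"
  shows "blinfun_apply (sqrt_iter B n) (C v) = C (blinfun_apply (sqrt_iter B n) v)"
proof -
  interpret C: bounded_linear C by fact
  show ?thesis
    by (induction n arbitrary: v) (simp_all add: blinfun.bilinear_simps BC C.zero C.add C.scaleR)
qed

lemma sqrt_iter_commute_sqrt_iter:
  "sqrt_iter B m o\<^sub>L sqrt_iter B n = sqrt_iter B n o\<^sub>L sqrt_iter B m"
proof -
  \<comment> \<open>The commutation lemma is used twice: first with \<open>C\<close> equal to
    \<open>B\<close>, then with \<open>C\<close> equal to an iterate.\<close>
  have "blinfun_apply B (blinfun_apply (sqrt_iter B n) v) = blinfun_apply (sqrt_iter B n) (blinfun_apply B v)"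
    for n v
    by (rule sqrt_iter_commute[symmetric]) (simp_all add: blinfun.bounded_linear_right)
  hence "blinfun_apply (sqrt_iter B m) (blinfun_apply (sqrt_iter B n) v)
      = blinfun_apply (sqrt_iter B n) (blinfun_apply (sqrt_iter B m) v)" for v
    by (intro sqrt_iter_commute blinfun.bounded_linear_right)
  thus ?thesis by (intro blinfun_eqI) simp
qed

lemma norm_sqrt_iter_le:
  assumes B: "norm B \<le> 1"
  shows "norm (sqrt_iter B n) \<le> sqrt_bound n"
proof (induction n)
  case (Suc n)
  have "norm (B + (sqrt_iter B n o\<^sub>L sqrt_iter B n))
      \<le> norm B + norm (sqrt_iter B n) * norm (sqrt_iter B n)"
    by (rule norm_triangle_le) (simp add: norm_blinfun_compose)
  also have "\<dots> \<le> 1 + sqrt_bound n * sqrt_bound n"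
    using B Suc sqrt_bound_range[of n] by (intro add_mono mult_mono) auto
  finally show ?case by (simp add: power2_eq_square)
qed simp

text \<open>Bounds the steps by those of a bounded increasing real sequence, hence by a summable
  series. Commuting iterates factor a difference of squares, exactly as for numbers.\<close>

lemma norm_sqrt_iter_step_le:
  assumes B: "norm B \<le> 1"
  shows "norm (sqrt_iter B (Suc n) - sqrt_iter B n) \<le> sqrt_bound (Suc n) - sqrt_bound n"
proof (induction n)
  case 0
  show ?case using B by simp
next
  case (Suc n)
  define Y Z y z where "Y = sqrt_iter B n" and "Z = sqrt_iter B (Suc n)"
    and "y = sqrt_bound n" and "z = sqrt_bound (Suc n)"
  have YZ: "Y o\<^sub>L Z = Z o\<^sub>L Y" unfolding Y_def Z_def by (rule sqrt_iter_commute_sqrt_iter)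
  have "(Z o\<^sub>L Z) - (Y o\<^sub>L Y) = (Z - Y) o\<^sub>L (Z + Y)"
    by (simp add: bounded_bilinear.add_right[OF bounded_bilinear_blinfun_compose]
        bounded_bilinear.diff_left[OF bounded_bilinear_blinfun_compose] YZ)
  moreover have "sqrt_iter B (Suc (Suc n)) - Z = (1/2) *\<^sub>R ((Z o\<^sub>L Z) - (Y o\<^sub>L Y))"
    by (simp add: Z_def Y_def scaleR_diff_right scaleR_add_right del: sqrt_iter.simps(2))
      (simp add: scaleR_diff_right scaleR_add_right)
  ultimately have "norm (sqrt_iter B (Suc (Suc n)) - Z) = norm ((Z - Y) o\<^sub>L (Z + Y)) / 2"
    by simp
  also have "\<dots> \<le> norm (Z - Y) * (norm Z + norm Y) / 2"
    using norm_blinfun_compose[of "Z - Y" "Z + Y"]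
      mult_left_mono[OF norm_triangle_ineq[of Z Y] norm_ge_zero[of "Z - Y"]] by linarith
  also have "\<dots> \<le> (z - y) * (z + y) / 2"
    using Suc norm_sqrt_iter_le[OF B, of n] norm_sqrt_iter_le[OF B, of "Suc n"] sqrt_bound_mono[of n]
    unfolding Y_def[symmetric] Z_def[symmetric] y_def[symmetric] z_def[symmetric]
    by (intro divide_right_mono mult_mono add_mono) (auto intro: order_trans[OF norm_ge_zero])
  also have "\<dots> = sqrt_bound (Suc (Suc n)) - sqrt_bound (Suc n)"
  proof -
    have "z = (1 + y\<^sup>2) / 2" by (simp add: z_def y_def)
    moreover have "sqrt_bound (Suc (Suc n)) = (1 + z\<^sup>2) / 2" by (simp add: z_def)
    ultimately show ?thesis unfolding z_def[symmetric] by (simp add: power2_eq_square field_simps)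
  qed
  finally show ?case by (simp add: Z_def)
qed

text \<open>The steps are absolutely summable by comparison with the telescoping scalar series;
  continuity of composition gives the fixed point equation in the limit.\<close>

lemma sqrt_iter_convergent:
  assumes B: "norm B \<le> 1"
  obtains Y where "sqrt_iter B \<longlonglongrightarrow> Y" "norm Y \<le> 1" "B + (Y o\<^sub>L Y) = 2 *\<^sub>R Y"
proof -
  have "incseq sqrt_bound" by (rule incseq_SucI) (rule sqrt_bound_mono)
  then obtain l where "sqrt_bound \<longlonglongrightarrow> l" using incseq_convergent[of sqrt_bound 1] sqrt_bound_range by blast
  hence "summable (\<lambda>n. sqrt_bound (Suc n) - sqrt_bound n)" by (rule telescope_summable)
  hence "summable (\<lambda>n. sqrt_iter B (Suc n) - sqrt_iter B n)"
    by (rule summable_comparison_test'[where N = 0]) (rule norm_sqrt_iter_step_le[OF B])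
  then obtain Y where Y: "sqrt_iter B \<longlonglongrightarrow> Y"
    unfolding summable_iff_convergent sum_lessThan_telescope convergent_def by auto
  have "(\<lambda>n. sqrt_iter B (Suc n)) \<longlonglongrightarrow> (1/2) *\<^sub>R (B + (Y o\<^sub>L Y))"
    unfolding sqrt_iter.simps
    by (intro tendsto_intros bounded_bilinear.tendsto[OF bounded_bilinear_blinfun_compose] Y)
  hence "Y = (1/2) *\<^sub>R (B + (Y o\<^sub>L Y))" using LIMSEQ_unique LIMSEQ_Suc[OF Y] by blast
  hence "2 *\<^sub>R Y = 2 *\<^sub>R ((1/2) *\<^sub>R (B + (Y o\<^sub>L Y)))" by simp
  hence "B + (Y o\<^sub>L Y) = 2 *\<^sub>R Y" by simp
  moreover have "norm (sqrt_iter B n) \<le> 1" for n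
    using norm_sqrt_iter_le[OF B, of n] sqrt_bound_range[of n] by linarith
  hence "norm Y \<le> 1" using tendsto_norm[OF Y] LIMSEQ_le_const2 by blast
  ultimately show thesis using Y that by blast
qed

text \<open>For \<open>B = 1 - A/M\<close>, of norm at most \<open>1\<close>, the limit
  \<open>Y\<close> satisfies \<open>(1 - Y)^2 = A/M\<close>, so the root is \<open>sqrt M\<close>
  times \<open>1 - Y\<close>. The commutation clause is what uniqueness of the root relies
  on.\<close>

lemma positive_sqrt_exists:
  fixes A :: "'a::chilbert_space \<Rightarrow> 'a"
  assumes A: "positive_op A"
  obtains S where "positive_op S" "S \<circ> S = A"
    "\<And>C. bounded_linear C \<Longrightarrow> A \<circ> C = C \<circ> A \<Longrightarrow> S \<circ> C = C \<circ> S"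
proof -
  interpret A: bounded_linear A using A by (simp add: positive_op_def bounded_clinear_def)
  obtain M where M: "M > 0" "\<And>v. norm (A v) \<le> norm v * M" using A.pos_bounded by blast
  define B where "B = Blinfun (\<lambda>v. v - (1/M) *\<^sub>R A v)"
  have B: "blinfun_apply B v = v - (1/M) *\<^sub>R A v" for v
    unfolding B_def
    by (subst bounded_linear_Blinfun_apply)
      (intro bounded_linear_sub bounded_linear_ident bounded_linear_const_scaleR A.bounded_linear, rule refl)
  \<comment> \<open>In the expanded square, the bound on \<open>norm (A v)\<close> absorbs the last
    term into half of the middle one.\<close>
  have "norm (blinfun_apply B v) \<le> 1 * norm v" for v
  proof -
    define a where "a = Re (cinner v (A v))"
    have a: "0 \<le> a" "(norm (A v))\<^sup>2 \<le> M * a"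
      using A positive_op_norm_square_le[OF A M] by (auto simp: a_def positive_op_def)
    have "(norm (blinfun_apply B v))\<^sup>2 = (norm v)\<^sup>2 - 2 * a / M + (norm (A v))\<^sup>2 / M\<^sup>2"
      by (simp only: B power2_norm_eq_Re_cinner a_def)
        (simp add: cinner_simps Re_cinner_commute[of "A v" v] power2_eq_square add_divide_distrib diff_divide_distrib)
    also have "\<dots> \<le> (norm v)\<^sup>2 - 2 * a / M + M * a / M\<^sup>2"
      using a by (intro add_left_mono divide_right_mono) auto
    also have "\<dots> = (norm v)\<^sup>2 - a / M" using M(1) by (simp add: power2_eq_square)
    also have "\<dots> \<le> (norm v)\<^sup>2" using a M(1) by simp
    finally show ?thesis by (simp add: power2_le_iff_abs_le)
  qed
  hence "norm B \<le> 1" by (intro norm_blinfun_bound) auto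
  then obtain Y where Y: "sqrt_iter B \<longlonglongrightarrow> Y" "norm Y \<le> 1" "B + (Y o\<^sub>L Y) = 2 *\<^sub>R Y"
    by (rule sqrt_iter_convergent)
  have lim: "(\<lambda>n. blinfun_apply (sqrt_iter B n) v) \<longlonglongrightarrow> blinfun_apply Y v" for v
    by (intro blinfun.tendsto Y tendsto_const)
  have Y_commute: "blinfun_apply Y (C v) = C (blinfun_apply Y v)"
    if C: "bounded_linear C" and AC: "\<And>v. A (C v) = C (A v)" for C v
  proof -
    interpret C: bounded_linear C by fact
    have "blinfun_apply (sqrt_iter B n) (C v) = C (blinfun_apply (sqrt_iter B n) v)" for n
      by (rule sqrt_iter_commute[OF C]) (simp add: B AC C.diff C.scaleR)
    with C.tendsto[OF lim[of v]] lim[of "C v"] show ?thesis by (simp add: LIMSEQ_unique)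
  qed
  have "cinner u (blinfun_apply (sqrt_iter B n) v) = cinner (blinfun_apply (sqrt_iter B n) u) v" for n u v
    by (induction n arbitrary: u v)
      (simp_all add: blinfun.bilinear_simps B cinner_simps positive_op_selfadjoint[OF A])
  hence Y_sym: "cinner u (blinfun_apply Y v) = cinner (blinfun_apply Y u) v" for u v
    using tendsto_cinner[OF tendsto_const[of u] lim[of v]]
      tendsto_cinner[OF lim[of u] tendsto_const[of v]] by (simp add: LIMSEQ_unique)
  define S where "S v = sqrt M *\<^sub>R (v - blinfun_apply Y v)" for v
  have S_linear: "bounded_linear S"
    unfolding S_def
    by (intro bounded_linear_const_scaleR bounded_linear_sub bounded_linear_ident blinfun.bounded_linear_right)
  have AC: "A (c *\<^sub>C v) = c *\<^sub>C A v" for c v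
    using A by (simp add: positive_op_def bounded_clinear_def)
  have S_commute: "S (C v) = C (S v)" if C: "bounded_linear C" and "\<And>v. A (C v) = C (A v)" for C v
  proof -
    interpret C: bounded_linear C by fact
    show ?thesis using Y_commute[OF that] by (simp add: S_def C.diff C.scaleR)
  qed
  \<comment> \<open>Bounded operators of type \<open>blinfun\<close> are only real linear; complex
    linearity follows because multiplication by \<open>c\<close> commutes with
    \<open>A\<close>.\<close>
  have "bounded_clinear S"
    unfolding bounded_clinear_def using S_linear S_commute[OF bounded_linear_scaleC AC] by blast
  moreover have "cinner v (S v) \<in> \<real> \<and> 0 \<le> Re (cinner v (S v))" for v
  proof -
    have "cnj (cinner v (blinfun_apply Y v)) = cinner v (blinfun_apply Y v)"
      using Y_sym[of v v] cinner_commute by metis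
    hence "cinner v (blinfun_apply Y v) \<in> \<real>" by (simp add: Reals_cnj_iff)
    moreover have "Re (cinner v (blinfun_apply Y v)) \<le> (norm v)\<^sup>2"
    proof -
      have "Re (cinner v (blinfun_apply Y v)) \<le> norm v * norm (blinfun_apply Y v)"
        using complex_Re_le_cmod cmod_cinner_le order_trans by blast
      also have "\<dots> \<le> norm v * (1 * norm v)"
        using norm_blinfun[of Y v] Y(2) mult_right_mono[OF Y(2) norm_ge_zero[of v]]
        by (intro mult_left_mono) auto
      finally show ?thesis by (simp add: power2_eq_square)
    qed
    ultimately show ?thesis using M(1) by (simp add: S_def cinner_simps cinner_self)
  qed
  ultimately have "positive_op S" by (simp add: positive_op_def)
  moreover have "S (S v) = A v" for v
  proof -
    have "blinfun_apply B v + blinfun_apply Y (blinfun_apply Y v) = 2 *\<^sub>R blinfun_apply Y v"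
      using arg_cong[OF Y(3), of "\<lambda>T. blinfun_apply T v"] by (simp add: blinfun.bilinear_simps)
    hence YY: "blinfun_apply Y (blinfun_apply Y v) = 2 *\<^sub>R blinfun_apply Y v - (v - (1/M) *\<^sub>R A v)"
      by (simp add: B algebra_simps)
    have "S (S v) = (sqrt M * sqrt M) *\<^sub>R
        (v - 2 *\<^sub>R blinfun_apply Y v + blinfun_apply Y (blinfun_apply Y v))"
      by (simp add: S_def blinfun.bilinear_simps scaleR_2 algebra_simps)
    thus ?thesis using M(1) by (simp add: YY)
  qed
  hence "S \<circ> S = A" by (simp add: fun_eq_iff)
  ultimately show thesis by (rule that) (use S_commute in \<open>simp add: fun_eq_iff\<close>)
qed

text \<open>A root \<open>T\<close> commutes with \<open>A\<close>, hence with \<open>S\<close>, so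
  \<open>S + T\<close> annihilates \<open>u = S v - T v\<close>. Positivity forces
  \<open>S u = T u = 0\<close>, and self-adjointness then gives \<open>u = 0\<close>.\<close>

lemma ex1_positive_sqrt:
  fixes A :: "'a::chilbert_space \<Rightarrow> 'a"
  assumes A: "positive_op A"
  shows "\<exists>!S. positive_op S \<and> S \<circ> S = A"
proof -
  obtain S where S: "positive_op S" "S \<circ> S = A"
    and S_commute: "\<And>C. bounded_linear C \<Longrightarrow> A \<circ> C = C \<circ> A \<Longrightarrow> S \<circ> C = C \<circ> S"
    using positive_sqrt_exists[OF A] by blast
  have "T = S" if T: "positive_op T" "T \<circ> T = A" for T
  proof
    fix v
    interpret S: bounded_linear S using S by (simp add: positive_op_def bounded_clinear_def)
    interpret T: bounded_linear T using T by (simp add: positive_op_def bounded_clinear_def)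
    have "S \<circ> T = T \<circ> S" by (rule S_commute[OF T.bounded_linear]) (simp add: T(2)[symmetric] comp_assoc)
    hence ST: "S (T w) = T (S w)" for w by (simp add: fun_eq_iff)
    have SS: "S (S w) = A w" "T (T w) = A w" for w using S(2) T(2) by (auto simp: fun_eq_iff)
    define u where "u = S v - T v"
    have "S u + T u = 0" by (simp add: u_def S.diff T.diff ST SS)
    hence "Re (cinner u (S u)) + Re (cinner u (T u)) = 0"
      by (metis cinner_add_right cinner_zero_right plus_complex.sel(1) zero_complex.sel(1))
    moreover have "0 \<le> Re (cinner u (S u))" "0 \<le> Re (cinner u (T u))"
      using S(1) T(1) by (auto simp: positive_op_def)
    ultimately have "S u = 0" "T u = 0"
      using positive_op_eq_0[OF S(1)] positive_op_eq_0[OF T(1)] by auto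
    moreover have "cinner u u = cinner (S u - T u) v"
      using positive_op_selfadjoint[OF S(1), of u v] positive_op_selfadjoint[OF T(1), of u v]
      by (simp add: u_def[symmetric] cinner_simps) (simp add: u_def cinner_simps)
    ultimately have "u = 0" by (simp add: cinner_zero_left cinner_self)
    thus "T v = S v" by (simp add: u_def)
  qed
  thus ?thesis using S by blast
qed

text \<open>Used contrapositively: if the root of a POVM element does not annihilate the
  perpendicular derivative, neither does the element itself.\<close>

lemma op_sqrt_eq_0:
  assumes A: "positive_op A" and 0: "A v = 0"
  shows "op_sqrt A v = 0"
proof -
  let ?S = "op_sqrt A"
  have S: "positive_op ?S" "?S \<circ> ?S = A"
    using theI'[OF ex1_positive_sqrt[OF A]] unfolding op_sqrt_def by blast+
  have "cinner (?S v) (?S v) = cinner v ((?S \<circ> ?S) v)"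
    using positive_op_selfadjoint[OF S(1), of v "?S v"] by simp
  thus ?thesis by (simp add: S(2) 0 cinner_zero_right cinner_self)
qed

section \<open>Quantum Fisher information of the post-selected states\<close>

lemma outcome_prob_eq:
  "bounded_clinear (K \<omega>) \<Longrightarrow> outcome_prob K \<psi> \<omega> x = (norm (K \<omega> (\<psi> x)))\<^sup>2"
  by (simp add: outcome_prob_def cinner_povm power2_norm_eq_Re_cinner)

lemma qfi_eq:
  "norm (\<phi> x) = 1 \<Longrightarrow> qfi \<phi> x = 4 * (norm (perp_deriv \<phi> x))\<^sup>2"
  by (simp add: qfi_def perp_deriv_def norm_diff_scaleC_square power2_norm_eq_Re_cinner[symmetric])

lemma metric_g_eq: "metric_g \<psi> x = (norm (perp_deriv \<psi> x))\<^sup>2"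
  by (simp add: metric_g_def power2_norm_eq_Re_cinner)

text \<open>Differentiating the normalisation only adds a multiple of the state, so its coefficient
  \<open>b\<close> is left unspecified.\<close>

lemma post_state_has_vector_derivative:
  fixes \<psi> :: "real \<Rightarrow> 'a::chilbert_space"
  assumes \<psi>: "(\<psi> has_vector_derivative D) (at x)"
    and K: "bounded_clinear (K \<omega>)" and nz: "K \<omega> (\<psi> x) \<noteq> 0"
  obtains b where "(post_state K \<psi> \<omega> has_vector_derivative
    (1 / norm (K \<omega> (\<psi> x))) *\<^sub>R K \<omega> D + b *\<^sub>R K \<omega> (\<psi> x)) (at x)"
proof -
  have K_lin: "bounded_linear (K \<omega>)" using K by (simp add: bounded_clinear_def)
  define f where "f y = K \<omega> (\<psi> y)" for y
  have f: "(f has_vector_derivative K \<omega> D) (at x)"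
    unfolding f_def by (rule bounded_linear.has_vector_derivative[OF K_lin \<psi>])
  \<comment> \<open>The squared norm as an inner product, so that the bilinear product rule gives
    its derivative.\<close>
  define N where "N y = Re (cinner (f y) (f y))" for y
  obtain n where n: "(N has_real_derivative n) (at x)"
    using bounded_linear.has_vector_derivative[OF bounded_linear_Re
        bounded_bilinear.has_vector_derivative[OF bounded_bilinear_cinner f f]]
    unfolding N_def has_real_derivative_iff_has_vector_derivative by blast
  have N: "N y = (norm (f y))\<^sup>2" for y by (simp add: N_def power2_norm_eq_Re_cinner)
  have N_pos: "N x > 0" using nz by (simp add: N f_def)
  have "((\<lambda>y. 1 / sqrt (N y)) has_real_derivative
      (- (n * (inverse (sqrt (N x)) / 2)) / (sqrt (N x) * sqrt (N x)))) (at x)"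
    using N_pos by (auto intro!: derivative_eq_intros n)
  from has_vector_derivative_scaleR[OF this f]
  have "((\<lambda>y. (1 / sqrt (N y)) *\<^sub>R f y) has_vector_derivative
      (1 / norm (K \<omega> (\<psi> x))) *\<^sub>R K \<omega> D +
      (- (n * (inverse (sqrt (N x)) / 2)) / (sqrt (N x) * sqrt (N x))) *\<^sub>R K \<omega> (\<psi> x)) (at x)"
    by (simp only: N f_def real_sqrt_abs abs_norm_cancel)
  moreover have "post_state K \<psi> \<omega> = (\<lambda>y. (1 / sqrt (N y)) *\<^sub>R f y)"
    by (simp add: fun_eq_iff post_state_def outcome_prob_eq[where K = K, OF K] N f_def)
  ultimately show thesis by (simp only: that)
qed

text \<open>Components of the derivative along the state do not contribute to the QFI, so neither
  the normalisation of the post-selected state nor the projection to the perpendicular part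
  of the derivative of \<open>\<psi>\<close> matters.\<close>

lemma qfi_post_state:
  fixes \<psi> :: "real \<Rightarrow> 'a::chilbert_space"
  assumes \<psi>: "\<psi> differentiable (at x)"
    and K: "bounded_clinear (K \<omega>)" and nz: "K \<omega> (\<psi> x) \<noteq> 0"
  defines "p \<equiv> (norm (K \<omega> (\<psi> x)))\<^sup>2" and "d \<equiv> perp_deriv \<psi> x"
  shows "qfi (post_state K \<psi> \<omega>) x =
    4 * ((norm (K \<omega> d))\<^sup>2 / p - (cmod (cinner (K \<omega> (\<psi> x)) (K \<omega> d)))\<^sup>2 / p\<^sup>2)"
proof -
  interpret K: bounded_linear "K \<omega>" using K by (simp add: bounded_clinear_def)
  have KC: "K \<omega> (c *\<^sub>C v) = c *\<^sub>C K \<omega> v" for c v using K by (simp add: bounded_clinear_def)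
  define D where "D = vector_derivative \<psi> (at x)"
  define a where "a = 1 / norm (K \<omega> (\<psi> x))"
  define c where "c = cinner (\<psi> x) D"
  define \<phi> where "\<phi> = post_state K \<psi> \<omega> x"
  have "(\<psi> has_vector_derivative D) (at x)"
    using \<psi> unfolding D_def by (simp add: vector_derivative_works)
  then obtain b where "(post_state K \<psi> \<omega> has_vector_derivative a *\<^sub>R K \<omega> D + b *\<^sub>R K \<omega> (\<psi> x)) (at x)"
    using post_state_has_vector_derivative[of \<psi> D x K \<omega>] K nz unfolding a_def by metis
  hence deriv: "vector_derivative (post_state K \<psi> \<omega>) (at x) = a *\<^sub>R K \<omega> D + b *\<^sub>R K \<omega> (\<psi> x)"
    by (rule vector_derivative_at)
  have \<phi>: "\<phi> = a *\<^sub>R K \<omega> (\<psi> x)"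
    by (simp add: \<phi>_def a_def post_state_def outcome_prob_eq[where K = K, OF K])
  have a_pos: "a > 0" using nz by (simp add: a_def)
  have norm_\<phi>: "norm \<phi> = 1" using nz by (simp add: \<phi> a_def)
  have D_eq: "D = d + c *\<^sub>C \<psi> x" by (simp add: d_def c_def D_def perp_deriv_def)
  \<comment> \<open>Collects both components along \<open>\<phi>\<close>: \<open>c\<close> from
    splitting \<open>D\<close>, \<open>b / a\<close> from the normalisation.\<close>
  define \<beta> where "\<beta> = c + of_real (b / a)"
  have "b *\<^sub>R K \<omega> (\<psi> x) = of_real (b / a) *\<^sub>C \<phi>"
    using a_pos by (simp add: \<phi> scaleR_scaleC scaleC_scaleC)
  moreover have "a *\<^sub>R K \<omega> D = a *\<^sub>R K \<omega> d + c *\<^sub>C \<phi>"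
    by (simp add: D_eq \<phi> K.add KC scaleR_scaleC scaleC_scaleC scaleC_add_right mult.commute)
  ultimately have deriv': "vector_derivative (post_state K \<psi> \<omega>) (at x) = a *\<^sub>R K \<omega> d + \<beta> *\<^sub>C \<phi>"
    by (simp add: deriv \<beta>_def scaleC_add_left)
  \<comment> \<open>Projecting off the unit vector \<open>\<phi>\<close> removes the
    \<open>\<beta>\<close> term.\<close>
  have "perp_deriv (post_state K \<psi> \<omega>) x = a *\<^sub>R K \<omega> d - cinner \<phi> (a *\<^sub>R K \<omega> d) *\<^sub>C \<phi>"
    using norm_\<phi> by (simp add: perp_deriv_def deriv' \<phi>_def[symmetric] cinner_add_right
        cinner_scaleC_right cinner_self scaleC_add_left)
  hence "qfi (post_state K \<psi> \<omega>) x
      = 4 * ((norm (a *\<^sub>R K \<omega> d))\<^sup>2 - (cmod (cinner \<phi> (a *\<^sub>R K \<omega> d)))\<^sup>2)"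
    using norm_\<phi> by (simp add: qfi_eq \<phi>_def[symmetric] norm_diff_scaleC_square[OF norm_\<phi>])
  thus ?thesis
    using a_pos by (simp add: \<phi> cinner_scaleR_left cinner_scaleR_right norm_mult power_mult_distrib)
      (simp add: a_def p_def power_divide power2_eq_square power4_eq_xxxx)
qed

text \<open>At \<open>s = 0\<close> the capacity is \<infinity>, which the open upper end of the
  interval excludes.\<close>

lemma capacity_efficient_iff:
  assumes "0 \<le> s"
  shows "1 / ereal s \<in> {1<..<\<infinity>} \<longleftrightarrow> 0 < s \<and> s < 1"
proof (cases "s = 0")
  case False
  hence "1 / ereal s = ereal (1 / s)" by (simp add: one_ereal_def)
  thus ?thesis using False assms by (auto simp: one_ereal_def field_simps)
qed (simp add: one_ereal_def)

text \<open>The factors \<open>4\<close> cancel in the ratio; multiplied by the outcome probability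
  it becomes a summand of the loss.\<close>

lemma outcome_information:
  fixes \<psi> :: "real \<Rightarrow> 'a::chilbert_space"
  assumes "\<psi> differentiable (at x)" "norm (\<psi> x) = 1"
    and K: "bounded_clinear (K \<omega>)" and nz: "outcome_prob K \<psi> \<omega> x \<noteq> 0"
  defines "d \<equiv> perp_deriv \<psi> x"
  shows "qfi (post_state K \<psi> \<omega>) x / qfi \<psi> x =
    ((norm (K \<omega> d))\<^sup>2 - (cmod (cinner (K \<omega> (\<psi> x)) (K \<omega> d)))\<^sup>2 / outcome_prob K \<psi> \<omega> x) /
      metric_g \<psi> x / outcome_prob K \<psi> \<omega> x"
proof -
  have "K \<omega> (\<psi> x) \<noteq> 0" using nz by (auto simp: outcome_prob_eq[where K = K, OF K])
  thus ?thesis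
    using assms by (simp add: qfi_post_state qfi_eq metric_g_eq outcome_prob_eq[where K = K, OF K]
        power2_eq_square diff_divide_distrib mult.commute mult.left_commute)
qed

text \<open>Completeness of the POVM, tested against \<open>v\<close>.\<close>

lemma sum_norm_square_post_selection:
  assumes "post_selection K \<Omega> R"
  shows "(\<Sum>\<omega>\<in>\<Omega>. (norm (K \<omega> v))\<^sup>2) = (norm v)\<^sup>2"
proof -
  have "Re (cinner v (\<Sum>\<omega>\<in>\<Omega>. povm K \<omega> v)) = (norm v)\<^sup>2"
    using assms by (simp add: post_selection_def cinner_self)
  moreover have "Re (cinner v (povm K \<omega> v)) = (norm (K \<omega> v))\<^sup>2" if "\<omega> \<in> \<Omega>" for \<omega>
    using assms that by (simp add: post_selection_def cinner_povm cinner_self)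
  ultimately show ?thesis by (simp add: cinner_sum_right)
qed

lemma perp_state_props:
  assumes \<psi>: "norm (\<psi> x) = 1" and g: "metric_g \<psi> x > 0"
  shows "cinner (perp_state \<psi> x) (perp_state \<psi> x) = 1"
    "cinner (perp_state \<psi> x) (\<psi> x) = 0" "cinner (\<psi> x) (perp_state \<psi> x) = 0"
    "perp_deriv \<psi> x = sqrt (metric_g \<psi> x) *\<^sub>R perp_state \<psi> x"
proof -
  let ?e = "perp_state \<psi> x"
  have "norm ?e = 1" using g by (simp add: perp_state_def metric_g_eq)
  thus "cinner ?e ?e = 1" by (simp add: cinner_self)
  have "cinner (\<psi> x) (perp_deriv \<psi> x) = 0" using \<psi> by (simp add: perp_deriv_def cinner_simps cinner_self)
  thus *: "cinner (\<psi> x) ?e = 0" by (simp add: perp_state_def cinner_simps)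
  show "cinner ?e (\<psi> x) = 0" using * cinner_commute[of ?e "\<psi> x"] by simp
  show "perp_deriv \<psi> x = sqrt (metric_g \<psi> x) *\<^sub>R ?e" using g by (simp add: perp_state_def)
qed

lemma bounded_clinear_ket_bra: "bounded_clinear (ket_bra u v)"
  unfolding ket_bra_def
proof (rule bounded_clinearI[where M = "norm v * norm u"])
  fix w
  show "norm (cinner v w *\<^sub>C u) \<le> norm w * (norm v * norm u)"
    using mult_right_mono[OF cmod_cinner_le[of v w] norm_ge_zero[of u]]
    by (simp add: norm_scaleC algebra_simps)
qed (simp_all add: cinner_simps scaleC_add_left scaleC_scaleC)

lemma bounded_clinear_diff:
  "bounded_clinear A \<Longrightarrow> bounded_clinear B \<Longrightarrow> bounded_clinear (\<lambda>v. A v - B v)"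
  unfolding bounded_clinear_def
  by (auto intro: bounded_linear_sub simp: linear_diff[OF bounded_linear.linear[OF bounded_linear_scaleC]])

lemma bounded_clinear_scaleR:
  "bounded_clinear A \<Longrightarrow> bounded_clinear (\<lambda>v. r *\<^sub>R A v)"
  using bounded_linear_const_scaleR[of A r] unfolding bounded_clinear_def
  by (simp add: scaleR_scaleC scaleC_scaleC mult.commute)

section \<open>Necessity and sufficiency of the decomposition\<close>

lemma lcc_form_exists:
  fixes \<psi> :: "real \<Rightarrow> 'a::chilbert_space"
  assumes diff: "\<psi> differentiable (at x)" and \<psi>: "norm (\<psi> x) = 1" and g: "metric_g \<psi> x > 0"
    and PS: "post_selection K \<Omega> R"
    and ret: "retained_nontrivial K R \<psi> x"
    and loss: "loss K R \<psi> x = 0" and eff: "efficient K R \<psi> x"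
  shows "\<exists>q \<Lambda> l. lcc_form (povm K) R \<psi> x q \<Lambda> l"
proof -
  define d where "d = perp_deriv \<psi> x"
  define e where "e = perp_state \<psi> x"
  define p where "p = (\<lambda>\<omega>. outcome_prob K \<psi> \<omega> x)"
  \<comment> \<open>This is the diagonal matrix element of the POVM element at \<open>e\<close>, the
    only value the decomposition permits.\<close>
  define q where "q = (\<lambda>\<omega>. (norm (K \<omega> d))\<^sup>2 / metric_g \<psi> x)"
  define z where "z = (\<lambda>\<omega>. cinner (K \<omega> (\<psi> x)) (K \<omega> d))"
  have fin: "finite \<Omega>" "R \<subseteq> \<Omega>" "finite R" using PS finite_subset by (auto simp: post_selection_def)
  have K: "bounded_clinear (K \<omega>)" if "\<omega> \<in> R" for \<omega> using PS that fin by (auto simp: post_selection_def)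
  have p: "p \<omega> = (norm (K \<omega> (\<psi> x)))\<^sup>2" if "\<omega> \<in> R" for \<omega>
    using K[OF that] by (simp add: p_def outcome_prob_eq)
  have p_pos: "p \<omega> > 0" if "\<omega> \<in> R" for \<omega>
  proof -
    have "p \<omega> \<noteq> 0" using ret that by (simp add: retained_nontrivial_def p_def)
    thus ?thesis by (simp add: p[OF that])
  qed
  have "1 = (\<Sum>\<omega>\<in>R. p \<omega> * (qfi (post_state K \<psi> \<omega>) x / qfi \<psi> x))"
    using loss by (simp add: loss_def p_def)
  also have "\<dots> = (\<Sum>\<omega>\<in>R. q \<omega> - (cmod (z \<omega>))\<^sup>2 / p \<omega> / metric_g \<psi> x)"
  proof (rule sum.cong)
    fix \<omega> assume "\<omega> \<in> R"
    with p_pos[OF this] have "qfi (post_state K \<psi> \<omega>) x / qfi \<psi> x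
        = (q \<omega> - (cmod (z \<omega>))\<^sup>2 / p \<omega> / metric_g \<psi> x) / p \<omega>"
      by (subst outcome_information)
        (simp_all add: K diff \<psi> p_def z_def q_def d_def diff_divide_distrib)
    with p_pos[OF \<open>\<omega> \<in> R\<close>] show "p \<omega> * (qfi (post_state K \<psi> \<omega>) x / qfi \<psi> x)
        = q \<omega> - (cmod (z \<omega>))\<^sup>2 / p \<omega> / metric_g \<psi> x"
      by simp
  qed simp
  finally have total: "(\<Sum>\<omega>\<in>R. q \<omega>) - (\<Sum>\<omega>\<in>R. (cmod (z \<omega>))\<^sup>2 / p \<omega> / metric_g \<psi> x) = 1"
    by (simp add: sum_subtractf)
  \<comment> \<open>Discarded outcomes contribute nonnegative terms, and completeness gives the full
    sum.\<close>
  have "(\<Sum>\<omega>\<in>R. (norm (K \<omega> d))\<^sup>2) \<le> (\<Sum>\<omega>\<in>\<Omega>. (norm (K \<omega> d))\<^sup>2)"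
    by (rule sum_mono2) (use fin in auto)
  also have "\<dots> = metric_g \<psi> x"
    using sum_norm_square_post_selection[OF PS, of d] by (simp add: metric_g_eq d_def)
  finally have "(\<Sum>\<omega>\<in>R. q \<omega>) \<le> 1" using g by (simp add: q_def sum_divide_distrib[symmetric])
  moreover have term_nonneg: "0 \<le> (cmod (z \<omega>))\<^sup>2 / p \<omega> / metric_g \<psi> x" if "\<omega> \<in> R" for \<omega>
    using p_pos[OF that] g by simp
  hence "0 \<le> (\<Sum>\<omega>\<in>R. (cmod (z \<omega>))\<^sup>2 / p \<omega> / metric_g \<psi> x)" by (rule sum_nonneg)
  \<comment> \<open>A number at most \<open>1\<close> minus a nonnegative number equals
    \<open>1\<close>, so both bounds are attained.\<close>
  ultimately have q_sum: "(\<Sum>\<omega>\<in>R. q \<omega>) = 1"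
    and "(\<Sum>\<omega>\<in>R. (cmod (z \<omega>))\<^sup>2 / p \<omega> / metric_g \<psi> x) = 0"
    using total by linarith+
  hence z0: "z \<omega> = 0" if "\<omega> \<in> R" for \<omega>
    using sum_nonneg_eq_0_iff[OF fin(3) term_nonneg] p_pos[OF that] g that by auto
  have q_pos: "0 < q \<omega>" if "\<omega> \<in> R" for \<omega>
  proof -
    have "povm K \<omega> d \<noteq> 0"
      using ret that op_sqrt_eq_0[OF positive_op_povm[where K = K, OF K[OF that]]]
      by (auto simp: retained_nontrivial_def d_def)
    moreover have "cadjoint (K \<omega>) 0 = 0"
      using bounded_clinear_cadjoint[OF K[OF that]]
      by (simp add: bounded_clinear_def linear_0 bounded_linear.linear)
    ultimately have "K \<omega> d \<noteq> 0" by (auto simp: povm_def)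
    thus ?thesis using g by (simp add: q_def)
  qed
  have q_le: "q \<omega> \<le> 1" if "\<omega> \<in> R" for \<omega>
    using member_le_sum[OF that _ fin(3), of q] q_pos q_sum by (force intro: less_imp_le)
  have p_nonneg: "0 \<le> p \<omega>" if "\<omega> \<in> R" for \<omega> using p_pos[OF that] by simp
  have "(\<Sum>\<omega>\<in>R. p \<omega>) < 1"
    using eff capacity_efficient_iff[OF sum_nonneg[of R p, OF p_nonneg]]
    by (simp add: efficient_def compression_capacity_def p_def)
  hence p_less: "p \<omega> < 1" if "\<omega> \<in> R" for \<omega>
    using member_le_sum[OF that _ fin(3), of p] p_nonneg by force
  note e = perp_state_props[OF \<psi> g, folded e_def d_def]
  have e_d: "e = (1 / sqrt (metric_g \<psi> x)) *\<^sub>R d" by (simp add: e_def d_def perp_state_def)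
  \<comment> \<open>As the remainder, it satisfies the decomposition by definition; only its matrix
    elements and boundedness need work.\<close>
  define \<Lambda> where "\<Lambda> = (\<lambda>\<omega> v. povm K \<omega> v - q \<omega> *\<^sub>R ket_bra e e v)"
  have "povm K \<omega> = (\<lambda>v. q \<omega> *\<^sub>R ket_bra e e v + \<Lambda> \<omega> v) \<and> q \<omega> \<in> {0<..1} \<and>
      bounded_clinear (\<Lambda> \<omega>) \<and> cinner e (\<Lambda> \<omega> e) = 0 \<and> cinner e (\<Lambda> \<omega> (\<psi> x)) = 0 \<and>
      cinner (\<psi> x) (\<Lambda> \<omega> (\<psi> x)) = complex_of_real (p \<omega>) \<and> p \<omega> \<in> {0<..<1}"
    if \<omega>: "\<omega> \<in> R" for \<omega>
  proof (intro conjI)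
    have Ke: "K \<omega> e = (1 / sqrt (metric_g \<psi> x)) *\<^sub>R K \<omega> d"
      using K[OF \<omega>] by (simp add: e_d bounded_clinear_def linear_scale bounded_linear.linear)
    have "cinner (K \<omega> e) (K \<omega> e) = of_real (q \<omega>)"
      using g by (simp add: cinner_self Ke q_def power_divide)
    thus "cinner e (\<Lambda> \<omega> e) = 0"
      by (simp add: \<Lambda>_def cinner_simps cinner_povm[where K = K, OF K[OF \<omega>]] ket_bra_def e)
    have "cinner (K \<omega> e) (K \<omega> (\<psi> x)) = 0"
      using z0[OF \<omega>] cinner_commute[of "K \<omega> d" "K \<omega> (\<psi> x)"] by (simp add: Ke z_def cinner_simps)
    thus "cinner e (\<Lambda> \<omega> (\<psi> x)) = 0"
      by (simp add: \<Lambda>_def cinner_simps cinner_povm[where K = K, OF K[OF \<omega>]] ket_bra_def e)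
    show "cinner (\<psi> x) (\<Lambda> \<omega> (\<psi> x)) = complex_of_real (p \<omega>)"
      by (simp add: \<Lambda>_def cinner_simps cinner_povm[where K = K, OF K[OF \<omega>]] ket_bra_def e p[OF \<omega>]
          cinner_self)
    show "bounded_clinear (\<Lambda> \<omega>)"
      unfolding \<Lambda>_def
      by (intro bounded_clinear_diff bounded_clinear_scaleR bounded_clinear_ket_bra
          bounded_clinear_povm K \<omega>)
  qed (use q_pos q_le p_pos p_less \<omega> in \<open>auto simp: \<Lambda>_def\<close>)
  hence "lcc_form (povm K) R \<psi> x q \<Lambda> p" unfolding lcc_form_def e_def[symmetric] using q_sum by blast
  thus ?thesis by blast
qed

text \<open>The form fixes the POVM element's matrix elements on the span of the state and its
  perpendicular state: \<open>q \<omega>\<close> and \<open>l \<omega>\<close> on the diagonal, zero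
  off it. Probability and relative information depend on these alone.\<close>

lemma lcc_form_outcome:
  fixes \<psi> :: "real \<Rightarrow> 'a::chilbert_space"
  assumes diff: "\<psi> differentiable (at x)" and \<psi>: "norm (\<psi> x) = 1" and g: "metric_g \<psi> x > 0"
    and K: "bounded_clinear (K \<omega>)"
    and form: "lcc_form (povm K) R \<psi> x q \<Lambda> l" and \<omega>: "\<omega> \<in> R"
  shows "outcome_prob K \<psi> \<omega> x = l \<omega>" "qfi (post_state K \<psi> \<omega>) x / qfi \<psi> x = q \<omega> / l \<omega>"
proof -
  define e where "e = perp_state \<psi> x"
  define d where "d = perp_deriv \<psi> x"
  note e = perp_state_props[OF \<psi> g, folded e_def d_def]
  have E: "povm K \<omega> v = q \<omega> *\<^sub>R ket_bra e e v + \<Lambda> \<omega> v" for v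
    using form \<omega> unfolding lcc_form_def e_def by metis
  have \<Lambda>: "cinner e (\<Lambda> \<omega> e) = 0" "cinner e (\<Lambda> \<omega> (\<psi> x)) = 0"
      "cinner (\<psi> x) (\<Lambda> \<omega> (\<psi> x)) = complex_of_real (l \<omega>)" and l_pos: "l \<omega> > 0"
    using form \<omega> unfolding lcc_form_def e_def by auto
  show p: "outcome_prob K \<psi> \<omega> x = l \<omega>"
    by (simp add: outcome_prob_def E cinner_simps ket_bra_def e \<Lambda>)
  have Kd: "K \<omega> d = sqrt (metric_g \<psi> x) *\<^sub>R K \<omega> e"
    using K by (simp add: e(4) bounded_clinear_def linear_scale bounded_linear.linear)
  have "cinner (K \<omega> e) (K \<omega> (\<psi> x)) = 0"
    by (simp add: cinner_povm[where K = K, OF K, symmetric] E cinner_simps ket_bra_def e \<Lambda>)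
  hence "cinner (K \<omega> (\<psi> x)) (K \<omega> d) = 0"
    using cinner_commute[of "K \<omega> (\<psi> x)" "K \<omega> e"] by (simp add: Kd cinner_simps)
  moreover have "cinner (K \<omega> e) (K \<omega> e) = of_real (q \<omega>)"
    by (simp add: cinner_povm[where K = K, OF K, symmetric] E cinner_simps ket_bra_def e \<Lambda>)
  hence "(norm (K \<omega> d))\<^sup>2 = metric_g \<psi> x * q \<omega>"
    using g by (simp only: power2_norm_eq_Re_cinner Kd cinner_simps) simp
  ultimately show "qfi (post_state K \<psi> \<omega>) x / qfi \<psi> x = q \<omega> / l \<omega>"
    using l_pos g by (simp add: outcome_information[where K = K, OF diff \<psi> K] p d_def)
qed

theorem theorem2:
  fixes \<psi> :: "real \<Rightarrow> 'a::chilbert_space"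
    and X :: "real set" and x :: real
    and K :: "'w \<Rightarrow> 'a \<Rightarrow> 'a" and \<Omega> R :: "'w set"
  assumes "open X" and "x \<in> X"
    and "\<And>y. y \<in> X \<Longrightarrow> norm (\<psi> y) = 1"
    and "\<And>y. y \<in> X \<Longrightarrow> \<psi> differentiable (at y)"
    and "qfi \<psi> x > 0"
    and "post_selection K \<Omega> R"
  shows
    "(retained_nontrivial K R \<psi> x \<and> lossless_compression K R \<psi> x \<and> efficient K R \<psi> x \<longrightarrow>
        (\<exists>q \<Lambda> l. lcc_form (povm K) R \<psi> x q \<Lambda> l)) \<and>
     (\<forall>q \<Lambda> l. lcc_form (povm K) R \<psi> x q \<Lambda> l \<and> (\<Sum>\<omega>\<in>R. l \<omega>) < 1 \<longrightarrow>
        lossless_compression K R \<psi> x \<and> efficient K R \<psi> x) \<and>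
     (\<forall>q \<Lambda> l. lcc_form (povm K) R \<psi> x q \<Lambda> l \<and>
        lossless_compression K R \<psi> x \<and> efficient K R \<psi> x \<longrightarrow>
        compression_capacity K R \<psi> x = ereal (1 / (\<Sum>\<omega>\<in>R. l \<omega>)) \<and>
        compression_gain K R \<psi> x = (\<Sum>\<omega>\<in>R. q \<omega> / l \<omega>))"
proof -
  have diff: "\<psi> differentiable (at x)" and \<psi>: "norm (\<psi> x) = 1" using assms by auto
  have g: "metric_g \<psi> x > 0" using \<open>qfi \<psi> x > 0\<close> \<psi> by (simp add: qfi_eq metric_g_eq)
  have R: "finite R" using assms(6) finite_subset by (auto simp: post_selection_def)
  have K: "bounded_clinear (K \<omega>)" if "\<omega> \<in> R" for \<omega> using assms(6) that by (auto simp: post_selection_def)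
  \<comment> \<open>One computation from an arbitrary decomposition serves both the converse and the
    formulas for capacity and gain.\<close>
  have "loss K R \<psi> x = 0 \<and> 0 < (\<Sum>\<omega>\<in>R. l \<omega>) \<and>
      compression_capacity K R \<psi> x = 1 / ereal (\<Sum>\<omega>\<in>R. l \<omega>) \<and>
      compression_gain K R \<psi> x = (\<Sum>\<omega>\<in>R. q \<omega> / l \<omega>)"
    if form: "lcc_form (povm K) R \<psi> x q \<Lambda> l" for q \<Lambda> l
  proof (intro conjI)
    note out = lcc_form_outcome[OF diff \<psi> g K form]
    have l_pos: "l \<omega> > 0" if "\<omega> \<in> R" for \<omega> using form that by (auto simp: lcc_form_def)
    have q: "(\<Sum>\<omega>\<in>R. q \<omega>) = 1" using form by (simp add: lcc_form_def)
    have "outcome_prob K \<psi> \<omega> x * qfi (post_state K \<psi> \<omega>) x / qfi \<psi> x = q \<omega>" if "\<omega> \<in> R" for \<omega>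
      using out[OF that that] l_pos[OF that]
      by (simp only: times_divide_eq_right[symmetric]) simp
    thus "loss K R \<psi> x = 0" by (simp add: loss_def q)
    \<comment> \<open>An empty sum could not equal \<open>1\<close>; nonemptiness makes the sum of
      the \<open>l \<omega>\<close> strictly positive and thus the capacity finite.\<close>
    have "R \<noteq> {}" using q by auto
    thus "0 < (\<Sum>\<omega>\<in>R. l \<omega>)" using l_pos R by (intro sum_pos) auto
    show "compression_capacity K R \<psi> x = 1 / ereal (\<Sum>\<omega>\<in>R. l \<omega>)"
      using out by (simp add: compression_capacity_def)
    show "compression_gain K R \<psi> x = (\<Sum>\<omega>\<in>R. q \<omega> / l \<omega>)"
      using out by (simp add: compression_gain_def)
  qed
  note form = this
  have "lossless_compression K R \<psi> x \<and> efficient K R \<psi> x"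
    if "lcc_form (povm K) R \<psi> x q \<Lambda> l" "(\<Sum>\<omega>\<in>R. l \<omega>) < 1" for q \<Lambda> l
    using form[OF that(1)] that(2) capacity_efficient_iff[of "\<Sum>\<omega>\<in>R. l \<omega>"]
    by (simp add: lossless_compression_def efficient_def)
  moreover have "compression_capacity K R \<psi> x = ereal (1 / (\<Sum>\<omega>\<in>R. l \<omega>))"
    if "lcc_form (povm K) R \<psi> x q \<Lambda> l" for q \<Lambda> l
    using form[OF that] by (simp add: one_ereal_def)
  ultimately show ?thesis
    using lcc_form_exists[OF diff \<psi> g assms(6)] form unfolding lossless_compression_def by blast
qed

end
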